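(* Let $X\subseteq\mathbb{R}^n$, let $f,g_1,\dots,g_m$ be smooth vector fields on $X$, and consider the control-affine system $$\dot x=f(x)+\sum_{i=1}^m g_i(x)u_i,\qquad x\in X,\quad u=[u_1,\dots,u_m]^\top\in\mathbb{R}^m,$$ with $f(x_0)=0$. If this system is Koopman linearizable, then the following two conditions hold: (i) $\dim\left(\operatorname{span}\{\operatorname{ad}_f^j g_i(x) : 1\le i\le m,\ j\ge 0\}\right)$ is constant for all $x\in\tilde V$; and (ii) $[\operatorname{ad}_f^k g_i,\operatorname{ad}_f^l g_j](x)=0$ for all $1\le i,j\le m$, all $k,l\ge 0$, and all $x\in\tilde V$, where $\tilde V$ is an open neighborhood of $x_0$.
   Context: Lie bracket convention: for vector fields $v,w$ on a subset of $\mathbb{R}^n$, $[v,w](x)=\nabla_x v(x)\cdot w(x)-\nabla_x w(x)\cdot v(x)$, where $\nabla_x$ denotes the Jacobian matrix. Repeated brackets: $\operatorname{ad}_f^0 g=g$ and $\operatorname{ad}_f^k g=[f,\operatorname{ad}_f^{k-1}g]$ for $k\ge 1$. Koopman linearizability: the system $\dot x=f(x)+\sum_{i=1}^m g_i(x)u_i$ is Koopman linearizable if there exist a set $X_0\subseteq X$, a diffeomorphism $\Phi\in\mathcal{C}^2(X_0,\mathbb{R}^N)$ from $X_0$ onto its image with $N\ge n$, and matrices $A$ and $B$, such that the transformed state $z(t)=\Phi(x(t))$ evolves according to the linear dynamics $\frac{d}{dt}z(t)=Az(t)+Bu(t)$ for any input $u(\cdot)$, any initial state $x(0)\in X_0$,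 and $t<\inf\{\tau>0 : x(\tau)\notin X_0\}$.
   Formalization: The set X_0 in the definition of Koopman linearizability is required to contain x_0 in its interior; for an arbitrary X_0 the claim fails (f=0, g(x)=x, x_0=0, X_0=(1,2), Φ=log). *)

theory Defs
  imports "HOL-Analysis.Analysis"
begin

text \<open>Differentiability classes. \<open>Ck_open k U f\<close> is only meaningful for open \<open>U\<close>; it says that
  all iterated directional derivatives of \<open>f\<close> up to order \<open>k\<close> exist on \<open>U\<close> (in the Frechet sense)
  and are continuous, which in finite dimension is the usual class \<open>C^k\<close>.\<close>

primrec Ck_open :: "nat \<Rightarrow> 'a::euclidean_space set \<Rightarrow> ('a \<Rightarrow> 'b::real_normed_vector) \<Rightarrow> bool" where
  "Ck_open 0 U f \<longleftrightarrow> continuous_on U f"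
| "Ck_open (Suc k) U f \<longleftrightarrow>
     (\<forall>x\<in>U. f differentiable (at x)) \<and>
     (\<forall>v. Ck_open k U (\<lambda>x. frechet_derivative f (at x) v))"

text \<open>Class \<open>C^k\<close> on an arbitrary subset \<open>S\<close> (\<open>k = \<infinity>\<close> allowed): near each point of \<open>S\<close> the function
  extends to a \<open>C^k\<close> function on an open set. For open \<open>S\<close> this is ordinary \<open>C^k\<close> regularity; the
  general form is needed for inverses defined on images such as \<open>\<Phi> ` X\<^sub>0\<close>, which need not be open.\<close>

definition Ck_on :: "enat \<Rightarrow> 'a::euclidean_space set \<Rightarrow> ('a \<Rightarrow> 'b::real_normed_vector) \<Rightarrow> bool" where
  "Ck_on k S f \<longleftrightarrow>
     (\<forall>x\<in>S. \<exists>U h. open U \<and> x \<in> U \<and> (\<forall>j. enat j \<le> k \<longrightarrow> Ck_open j U h) \<and>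
        (\<forall>y\<in>S \<inter> U. h y = f y))"

definition Ck_diffeo_onto_image ::
    "enat \<Rightarrow> 'a::euclidean_space set \<Rightarrow> ('a \<Rightarrow> 'b::euclidean_space) \<Rightarrow> bool" where
  "Ck_diffeo_onto_image k S \<Phi> \<longleftrightarrow>
     Ck_on k S \<Phi> \<and> (\<exists>\<Psi>. Ck_on k (\<Phi> ` S) \<Psi> \<and> (\<forall>x\<in>S. \<Psi> (\<Phi> x) = x))"

text \<open>The sign convention for the bracket is the opposite of the differential-geometric one.\<close>

definition lie_bracket ::
    "(real^'n \<Rightarrow> real^'n) \<Rightarrow> (real^'n \<Rightarrow> real^'n) \<Rightarrow> real^'n \<Rightarrow> real^'n" where
  "lie_bracket v w = (\<lambda>x. jacobian v (at x) *v w x - jacobian w (at x) *v v x)"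

primrec ad :: "(real^'n \<Rightarrow> real^'n) \<Rightarrow> nat \<Rightarrow> (real^'n \<Rightarrow> real^'n) \<Rightarrow> real^'n \<Rightarrow> real^'n" where
  "ad f 0 g = g"
| "ad f (Suc k) g = lie_bracket f (ad f k g)"

text \<open>\<open>x\<close> is a trajectory in \<open>X\<close> on the time interval \<open>[0, T)\<close> for the input \<open>u\<close>. The input is an
  arbitrary function of time; the derivative at \<open>0\<close> is one-sided.\<close>

definition trajectory ::
    "(real^'n) set \<Rightarrow> (real^'n \<Rightarrow> real^'n) \<Rightarrow> ('m::finite \<Rightarrow> real^'n \<Rightarrow> real^'n) \<Rightarrow>
     (real \<Rightarrow> real^'m) \<Rightarrow> real \<Rightarrow> (real \<Rightarrow> real^'n) \<Rightarrow> bool" where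
  "trajectory X f g u T x \<longleftrightarrow>
     (\<forall>t\<in>{0..<T}. x t \<in> X \<and>
        (x has_vector_derivative (f (x t) + (\<Sum>i\<in>UNIV. (u t $ i) *\<^sub>R g i (x t))))
          (at t within {0..<T}))"

text \<open>\<open>\<infinity>\<close> if the trajectory does not leave \<open>X\<^sub>0\<close> during \<open>(0, T)\<close>.\<close>

definition exit_time :: "'a set \<Rightarrow> real \<Rightarrow> (real \<Rightarrow> 'a) \<Rightarrow> ereal" where
  "exit_time X\<^sub>0 T x = Inf (ereal ` {\<tau>. 0 < \<tau> \<and> \<tau> < T \<and> x \<tau> \<notin> X\<^sub>0})"

text \<open>Koopman linearizability near \<open>x\<^sub>0\<close>. The lifted dimension \<open>N\<close> is carried by the type argument
  \<open>'N\<close>; in a hypothesis, a free \<open>'N\<close> amounts to an existentially quantified \<open>N\<close>. The domain \<open>X\<^sub>0\<close> is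
  required to be a neighbourhood of \<open>x\<^sub>0\<close>, not necessarily open: without such a requirement
  \<open>X\<^sub>0 = {}\<close> or \<open>X\<^sub>0 = {x\<^sub>0}\<close> could make the notion vacuous.\<close>

definition koopman_linearizable ::
    "'N::finite itself \<Rightarrow> (real^'n) set \<Rightarrow> (real^'n \<Rightarrow> real^'n) \<Rightarrow>
     ('m::finite \<Rightarrow> real^'n \<Rightarrow> real^'n) \<Rightarrow> real^'n \<Rightarrow> bool" where
  "koopman_linearizable (_ :: 'N itself) X f g x\<^sub>0 \<longleftrightarrow>
     CARD('n) \<le> CARD('N) \<and>
     (\<exists>X\<^sub>0 (\<Phi> :: real^'n \<Rightarrow> real^'N) (A :: real^'N^'N) (B :: real^'m^'N).
        X\<^sub>0 \<subseteq> X \<and> x\<^sub>0 \<in> interior X\<^sub>0 \<and> Ck_diffeo_onto_image 2 X\<^sub>0 \<Phi> \<and>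
        (\<forall>u T x. trajectory X f g u T x \<and> x 0 \<in> X\<^sub>0 \<longrightarrow>
           (\<forall>t\<in>{0..<T}. ereal t < exit_time X\<^sub>0 T x \<longrightarrow>
              ((\<lambda>s. \<Phi> (x s)) has_vector_derivative (A *v \<Phi> (x t) + B *v u t))
                (at t within {0..<T}))))"

end

theory Submission
  imports Defs
begin

text \<open>Running the system with a constant input \<open>c\<close> from a point \<open>x\<close> near \<open>x\<^sub>0\<close> and differentiating
  \<open>\<Phi>\<close> along the solution at time \<open>0\<close> gives \<open>D\<Phi>(x) f(x) = A \<Phi>(x)\<close> and \<open>D\<Phi>(x) g\<^sub>i(x) = b\<^sub>i\<close>, where
  \<open>b\<^sub>i\<close> is the \<open>i\<close>-th column of \<open>B\<close>. So \<open>\<Phi>\<close> pushes \<open>f\<close> to a linear and each \<open>g\<^sub>i\<close> to a constant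
  vector field. By symmetry of \<open>D\<^sup>2\<Phi>\<close>, pushing forward commutes with brackets; hence
  \<open>ad\<^sub>f\<^sup>k g\<^sub>i\<close> is pushed to the constant \<open>A\<^sup>k b\<^sub>i\<close>, and the bracket of two such fields to \<open>0\<close>. Since
  \<open>D\<Phi>(x)\<close> is injective, the brackets vanish and the span has the dimension of the span of
  all \<open>A\<^sup>k b\<^sub>i\<close>.\<close>

section \<open>The classes \<open>C\<^sup>k\<close>\<close>

lemma Ck_open_subset:
  assumes "Ck_open k U f" "V \<subseteq> U"
  shows "Ck_open k V f"
  using assms by (induction k arbitrary: f) (auto intro: continuous_on_subset)

text \<open>Differentiability is not assumed: \<open>frechet_derivative\<close> is a choice from the
  predicate \<open>has_derivative\<close>, and functions that agree near \<open>x\<close> satisfy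
  the same predicate, so the choices agree as well.\<close>

lemma frechet_derivative_transform_open:
  assumes "open U" "x \<in> U" "\<And>y. y \<in> U \<Longrightarrow> f y = h y"
  shows "frechet_derivative f (at x) = frechet_derivative h (at x)"
proof -
  have "(f has_derivative f') (at x) \<longleftrightarrow> (h has_derivative f') (at x)" for f'
    using assms
    using has_derivative_transform_within_open[of f f' x UNIV U h]
      has_derivative_transform_within_open[of h f' x UNIV U f] by auto
  then show ?thesis
    by (simp add: frechet_derivative_def)
qed

lemma Ck_open_cong:
  assumes "Ck_open k U h" "open U" "\<And>y. y \<in> U \<Longrightarrow> f y = h y"
  shows "Ck_open k U f"
  using assms(1,3)
proof (induction k arbitrary: f h)
  case 0
  then show ?case by (auto cong: continuous_on_cong)
next
  case (Suc k)
  have "f differentiable (at x)" if "x \<in> U" for x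
    using Suc.prems that \<open>open U\<close> unfolding differentiable_def Ck_open.simps
    by (metis has_derivative_transform_within_open)
  moreover have "Ck_open k U (\<lambda>x. frechet_derivative f (at x) v)" for v
  proof (rule Suc.IH[of "\<lambda>x. frechet_derivative h (at x) v"])
    show "Ck_open k U (\<lambda>x. frechet_derivative h (at x) v)"
      using Suc.prems by simp
    show "frechet_derivative f (at y) v = frechet_derivative h (at y) v" if "y \<in> U" for y
      using frechet_derivative_transform_open[OF \<open>open U\<close> that] Suc.prems by metis
  qed
  ultimately show ?case by simp
qed

lemma Ck_open_local:
  assumes "\<And>x. x \<in> V \<Longrightarrow> \<exists>U. open U \<and> x \<in> U \<and> Ck_open k U f"
  shows "Ck_open k V f"
  using assms
proof (induction k arbitrary: f)
  case 0
  then have "isCont f x" if "x \<in> V" for x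
    using that by (metis Ck_open.simps(1) continuous_on_eq_continuous_at)
  then show ?case
    by (simp add: continuous_at_imp_continuous_on)
next
  case (Suc k)
  have "f differentiable (at x)" if "x \<in> V" for x
    using Suc.prems[OF that] by auto
  moreover have "Ck_open k V (\<lambda>x. frechet_derivative f (at x) v)" for v
  proof (rule Suc.IH)
    fix x assume "x \<in> V"
    from Suc.prems[OF this]
    show "\<exists>U. open U \<and> x \<in> U \<and> Ck_open k U (\<lambda>x. frechet_derivative f (at x) v)"
      by auto
  qed
  ultimately show ?case by simp
qed

text \<open>Near a point of \<open>V\<close> the local extension \<open>h\<close> coincides with
  \<open>f\<close> on the open set \<open>U \<inter> V\<close>, so \<open>f\<close> inherits its
  regularity there; locality then covers all of \<open>V\<close>.\<close>

lemma Ck_on_imp_Ck_open: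
  assumes "Ck_on k S f" "open V" "V \<subseteq> S" "enat j \<le> k"
  shows "Ck_open j V f"
proof (rule Ck_open_local)
  fix x assume "x \<in> V"
  then have "x \<in> S" using assms(3) by blast
  with assms(1) obtain U h where "open U" "x \<in> U" "\<forall>j. enat j \<le> k \<longrightarrow> Ck_open j U h"
    "\<forall>y\<in>S \<inter> U. h y = f y"
    unfolding Ck_on_def by meson
  with assms(4) have U: "open U" "x \<in> U" "Ck_open j U h" "\<forall>y\<in>S \<inter> U. h y = f y"
    by simp_all
  have "Ck_open j (U \<inter> V) f"
    by (rule Ck_open_cong[of _ _ h]) (use U assms in \<open>auto intro: Ck_open_subset\<close>)
  with U \<open>x \<in> V\<close> \<open>open V\<close> show "\<exists>U. open U \<and> x \<in> U \<and> Ck_open j U f"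
    by (intro exI[of _ "U \<inter> V"]) auto
qed

lemma Ck_diffeo_onto_image_imp_Ck_open:
  assumes "Ck_diffeo_onto_image k S \<Phi>" "open V" "V \<subseteq> S" "enat j \<le> k"
  shows "Ck_open j V \<Phi>"
  using assms Ck_on_imp_Ck_open unfolding Ck_diffeo_onto_image_def by blast

lemma Ck_open_Suc_has_derivative:
  assumes "Ck_open (Suc k) U f" "x \<in> U"
  shows "(f has_derivative frechet_derivative f (at x)) (at x)"
  using assms by (simp add: frechet_derivative_works)

lemma Ck_open_Suc_Suc_has_derivative:
  assumes "Ck_open (Suc (Suc k)) U f" "x \<in> U"
  shows "((\<lambda>y. frechet_derivative f (at y) v) has_derivative
           frechet_derivative (\<lambda>y. frechet_derivative f (at y) v) (at x)) (at x)"
  using assms by (simp add: frechet_derivative_works)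

lemma linear_euclidean_representation:
  fixes l :: "'a::euclidean_space \<Rightarrow> 'b::real_vector"
  assumes "linear l"
  shows "l v = (\<Sum>b\<in>Basis. (v \<bullet> b) *\<^sub>R l b)"
proof -
  have "l v = l (\<Sum>b\<in>Basis. (v \<bullet> b) *\<^sub>R b)" by (simp add: euclidean_representation)
  also have "\<dots> = (\<Sum>b\<in>Basis. (v \<bullet> b) *\<^sub>R l b)"
    using assms by (simp add: linear_sum linear_cmul)
  finally show ?thesis .
qed

text \<open>\<open>Ck_open\<close> gives continuity of the derivative one direction at a time.
  Bounds on the compact ball along the basis vectors add up to a bound on the operator norm, and the
  ball is convex, so the mean value inequality applies.\<close>

lemma Ck_open_Suc_lipschitz_on_cball:
  fixes f :: "'a::euclidean_space \<Rightarrow> 'b::real_normed_vector"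
  assumes f: "Ck_open (Suc 0) U f" and K: "cball x r \<subseteq> U"
  obtains L where "L-lipschitz_on (cball x r) f"
proof -
  have "\<exists>B. \<forall>y\<in>cball x r. norm (frechet_derivative f (at y) b) \<le> B" for b
  proof -
    have "continuous_on (cball x r) (\<lambda>y. frechet_derivative f (at y) b)"
      using f K by (auto intro: continuous_on_subset)
    then have "bounded ((\<lambda>y. frechet_derivative f (at y) b) ` cball x r)"
      by (intro compact_imp_bounded compact_continuous_image) auto
    then show ?thesis
      by (auto simp: bounded_iff)
  qed
  then obtain B where B: "\<And>b y. y \<in> cball x r \<Longrightarrow> norm (frechet_derivative f (at y) b) \<le> B b"
    by metis
  define L where "L = (\<Sum>b\<in>Basis. \<bar>B b\<bar>)"
  have L: "norm (frechet_derivative f (at y) h) \<le> L * norm h" if y: "y \<in> cball x r" for y h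
  proof -
    have "linear (frechet_derivative f (at y))"
      using f K y by (intro linear_frechet_derivative) auto
    then have "frechet_derivative f (at y) h
        = (\<Sum>b\<in>Basis. (h \<bullet> b) *\<^sub>R frechet_derivative f (at y) b)"
      by (rule linear_euclidean_representation)
    also have "norm \<dots> \<le> (\<Sum>b\<in>Basis. \<bar>B b\<bar> * norm h)"
    proof (rule sum_norm_le)
      fix b :: 'a assume b: "b \<in> Basis"
      have "\<bar>h \<bullet> b\<bar> * norm (frechet_derivative f (at y) b) \<le> norm h * \<bar>B b\<bar>"
        using B[OF y, of b] Basis_le_norm[OF b, of h] by (intro mult_mono) auto
      then show "norm ((h \<bullet> b) *\<^sub>R frechet_derivative f (at y) b) \<le> \<bar>B b\<bar> * norm h"
        by (simp add: mult.commute)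
    qed
    finally show ?thesis by (simp add: L_def sum_distrib_right)
  qed
  have "L-lipschitz_on (cball x r) f"
  proof (rule lipschitz_onI)
    show "0 \<le> L" by (simp add: L_def sum_nonneg)
    fix y z assume yz: "y \<in> cball x r" "z \<in> cball x r"
    have "norm (f y - f z) \<le> L * norm (y - z)"
    proof (rule differentiable_bound[of "cball x r" f "\<lambda>y. frechet_derivative f (at y)"])
      show "(f has_derivative frechet_derivative f (at y)) (at y within cball x r)"
        if "y \<in> cball x r" for y
        using Ck_open_Suc_has_derivative[OF f] K that
        by (blast intro: has_derivative_at_withinI)
      show "onorm (frechet_derivative f (at y)) \<le> L" if "y \<in> cball x r" for y
        using L[OF that] by (rule onorm_le)
    qed (use yz in auto)
    then show "dist (f y) (f z) \<le> L * dist y z" by (simp add: dist_norm)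
  qed
  then show thesis by (rule that)
qed

section \<open>Symmetry of the second derivative\<close>

lemma second_difference_mean_value:
  fixes \<phi> :: "'a::real_normed_vector \<Rightarrow> real"
  assumes "0 < s"
    and D: "\<And>a b. \<lbrakk>0 \<le> a; a \<le> s; 0 \<le> b; b \<le> s\<rbrakk> \<Longrightarrow>
      (\<phi> has_derivative D (x + a *\<^sub>R u + b *\<^sub>R v)) (at (x + a *\<^sub>R u + b *\<^sub>R v))"
    and D2: "\<And>a b. \<lbrakk>0 \<le> a; a \<le> s; 0 \<le> b; b \<le> s\<rbrakk> \<Longrightarrow>
      ((\<lambda>y. D y v) has_derivative D2 (x + a *\<^sub>R u + b *\<^sub>R v)) (at (x + a *\<^sub>R u + b *\<^sub>R v))"
  obtains a b where "0 < a" "a < s" "0 < b" "b < s"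
    "\<phi> (x + s *\<^sub>R u + s *\<^sub>R v) - \<phi> (x + s *\<^sub>R u) - \<phi> (x + s *\<^sub>R v) + \<phi> x
      = s\<^sup>2 * D2 (x + a *\<^sub>R u + b *\<^sub>R v) u"
proof -
  \<comment> \<open>The second difference is a first difference of \<open>p\<close>; the mean value theorem is applied in
    the direction \<open>v\<close> and then in the direction \<open>u\<close>.\<close>
  define p where "p = (\<lambda>b. \<phi> (x + s *\<^sub>R u + b *\<^sub>R v) - \<phi> (x + b *\<^sub>R v))"
  have dp: "(p has_real_derivative (D (x + s *\<^sub>R u + b *\<^sub>R v) v - D (x + b *\<^sub>R v) v)) (at b)"
    if "0 \<le> b" "b \<le> s" for b
  proof -
    have 1: "(\<phi> has_derivative D (x + a *\<^sub>R u + b *\<^sub>R v)) (at (x + a *\<^sub>R u + b *\<^sub>R v))"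
      if "0 \<le> a" "a \<le> s" for a
      using D that \<open>0 \<le> b\<close> \<open>b \<le> s\<close> by blast
    have 2: "((\<lambda>b. \<phi> (x + a *\<^sub>R u + b *\<^sub>R v)) has_derivative
        (\<lambda>h. D (x + a *\<^sub>R u + b *\<^sub>R v) (h *\<^sub>R v))) (at b)" if "0 \<le> a" "a \<le> s" for a
      using 1[OF that]
      by (rule has_derivative_compose[rotated]) (auto intro!: derivative_eq_intros)
    have 3: "D (x + a *\<^sub>R u + b *\<^sub>R v) (h *\<^sub>R v) = h * D (x + a *\<^sub>R u + b *\<^sub>R v) v"
      if "0 \<le> a" "a \<le> s" for a h
      using has_derivative_linear[OF 1[OF that]] by (simp add: linear_cmul)
    have "(p has_derivative (\<lambda>h. D (x + s *\<^sub>R u + b *\<^sub>R v) (h *\<^sub>R v) - D (x + b *\<^sub>R v) (h *\<^sub>R v))) (at b)"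
      unfolding p_def using 2[of s] 2[of 0] \<open>0 < s\<close> by (intro has_derivative_diff) auto
    then show ?thesis
    proof (rule has_derivative_imp_has_field_derivative)
      show "h * (D (x + s *\<^sub>R u + b *\<^sub>R v) v - D (x + b *\<^sub>R v) v)
          = D (x + s *\<^sub>R u + b *\<^sub>R v) (h *\<^sub>R v) - D (x + b *\<^sub>R v) (h *\<^sub>R v)" for h
        using 3[of s h] 3[of 0 h] \<open>0 < s\<close> by (simp add: right_diff_distrib)
    qed
  qed
  obtain b where b: "0 < b" "b < s"
    "p s - p 0 = (s - 0) * (D (x + s *\<^sub>R u + b *\<^sub>R v) v - D (x + b *\<^sub>R v) v)"
    using MVT2[OF \<open>0 < s\<close>, of p "\<lambda>b. D (x + s *\<^sub>R u + b *\<^sub>R v) v - D (x + b *\<^sub>R v) v"] dp by blast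
  have dq: "((\<lambda>a. D (x + a *\<^sub>R u + b *\<^sub>R v) v) has_real_derivative D2 (x + a *\<^sub>R u + b *\<^sub>R v) u) (at a)"
    if "0 \<le> a" "a \<le> s" for a
  proof -
    have 1: "((\<lambda>y. D y v) has_derivative D2 (x + a *\<^sub>R u + b *\<^sub>R v)) (at (x + a *\<^sub>R u + b *\<^sub>R v))"
      using D2 that b by auto
    have 2: "((\<lambda>a. D (x + a *\<^sub>R u + b *\<^sub>R v) v) has_derivative
        (\<lambda>h. D2 (x + a *\<^sub>R u + b *\<^sub>R v) (h *\<^sub>R u))) (at a)"
      using 1
      by (rule has_derivative_compose[rotated]) (auto intro!: derivative_eq_intros)
    then show ?thesis
      by (rule has_derivative_imp_has_field_derivative)
        (use has_derivative_linear[OF 1] in \<open>simp add: linear_cmul\<close>)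
  qed
  obtain a where a: "0 < a" "a < s"
    "D (x + s *\<^sub>R u + b *\<^sub>R v) v - D (x + 0 *\<^sub>R u + b *\<^sub>R v) v = (s - 0) * D2 (x + a *\<^sub>R u + b *\<^sub>R v) u"
    using MVT2[OF \<open>0 < s\<close>, of "\<lambda>a. D (x + a *\<^sub>R u + b *\<^sub>R v) v" "\<lambda>a. D2 (x + a *\<^sub>R u + b *\<^sub>R v) u"] dq
    by blast
  have "p s - p 0 = s\<^sup>2 * D2 (x + a *\<^sub>R u + b *\<^sub>R v) u"
    using a b by (simp add: power2_eq_square)
  then show thesis
    by (intro that[OF a(1,2) b(1,2)]) (simp add: p_def)
qed

text \<open>The second difference over the parallelogram spanned by \<open>s *\<^sub>R u\<close> and
  \<open>s *\<^sub>R v\<close> is symmetric in \<open>u\<close> and \<open>v\<close>, yet equals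
  \<open>s\<^sup>2\<close> times either mixed derivative at a suitable nearby point. By continuity
  the two mixed derivatives at \<open>x\<close> cannot differ.\<close>

lemma second_derivative_symmetric_real:
  fixes \<phi> :: "'a::real_normed_vector \<Rightarrow> real"
  assumes "open V" "x \<in> V"
    and D: "\<And>y. y \<in> V \<Longrightarrow> (\<phi> has_derivative D y) (at y)"
    and D2: "\<And>y w. y \<in> V \<Longrightarrow> ((\<lambda>y. D y w) has_derivative D2 w y) (at y)"
    and cont: "\<And>w h. continuous_on V (\<lambda>y. D2 w y h)"
  shows "D2 v x u = D2 u x v"
proof (rule ccontr)
  assume "D2 v x u \<noteq> D2 u x v"
  \<comment> \<open>Half the gap: two values, each within less than \<open>e\<close> of its own
    limit, cannot coincide.\<close>
  define e where "e = \<bar>D2 v x u - D2 u x v\<bar> / 2"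
  have "e > 0" using \<open>D2 v x u \<noteq> D2 u x v\<close> by (simp add: e_def)
  have near: "\<exists>d>0. \<forall>y. dist y x < d \<longrightarrow> y \<in> V \<and> \<bar>D2 w y h - D2 w x h\<bar> < e" for w h
  proof -
    have "isCont (\<lambda>y. D2 w y h) x"
      using cont[of w h] assms by (simp add: continuous_on_eq_continuous_at)
    then obtain d1 where "d1 > 0" "\<forall>y. dist y x < d1 \<longrightarrow> \<bar>D2 w y h - D2 w x h\<bar> < e"
      using \<open>e > 0\<close> unfolding continuous_at_eps_delta
      by (metis dist_real_def)
    moreover obtain d2 where "d2 > 0" "\<forall>y. dist y x < d2 \<longrightarrow> y \<in> V"
      using assms unfolding open_dist by blast
    ultimately show ?thesis by (intro exI[of _ "min d1 d2"]) auto
  qed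
  obtain d1 where d1: "d1 > 0" "\<And>y. dist y x < d1 \<Longrightarrow> y \<in> V \<and> \<bar>D2 v y u - D2 v x u\<bar> < e"
    using near by blast
  obtain d2 where d2: "d2 > 0" "\<And>y. dist y x < d2 \<Longrightarrow> y \<in> V \<and> \<bar>D2 u y v - D2 u x v\<bar> < e"
    using near by blast
  \<comment> \<open>Small enough for the whole parallelogram to lie within \<open>min d1 d2\<close>
    of \<open>x\<close>. The summand 1 avoids division by zero for \<open>u = v = 0\<close> and
    makes the estimate strict.\<close>
  define s where "s = min d1 d2 / (norm u + norm v + 1)"
  have pos: "norm u + norm v + 1 > 0" by (simp add: add_nonneg_pos)
  have "s > 0" using d1 d2 pos by (simp add: s_def)
  \<comment> \<open>The primed vectors let one estimate serve both orders of the directions.\<close>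
  have close: "dist (x + a *\<^sub>R u' + b *\<^sub>R v') x < min d1 d2"
    if "0 \<le> a" "a \<le> s" "0 \<le> b" "b \<le> s" "{u', v'} = {u, v}" for a b u' v'
  proof -
    have uv: "norm u' + norm v' = norm u + norm v"
      using that(5) by (auto simp: doubleton_eq_iff)
    have "dist (x + a *\<^sub>R u' + b *\<^sub>R v') x = norm (a *\<^sub>R u' + b *\<^sub>R v')"
      by (simp add: dist_norm add.assoc)
    also have "\<dots> \<le> a * norm u' + b * norm v'"
      using that by (metis norm_triangle_ineq norm_scaleR abs_of_nonneg)
    also have "\<dots> \<le> s * norm u' + s * norm v'"
      using that by (intro add_mono mult_right_mono) auto
    also have "\<dots> = s * (norm u + norm v)" by (metis uv distrib_left)
    also have "\<dots> < s * (norm u + norm v + 1)" using \<open>s > 0\<close> by simp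
    also have "\<dots> = min d1 d2" using pos by (simp add: s_def)
    finally show ?thesis .
  qed
  obtain a b where ab: "0 < a" "a < s" "0 < b" "b < s"
    "\<phi> (x + s *\<^sub>R u + s *\<^sub>R v) - \<phi> (x + s *\<^sub>R u) - \<phi> (x + s *\<^sub>R v) + \<phi> x
      = s\<^sup>2 * D2 v (x + a *\<^sub>R u + b *\<^sub>R v) u"
    by (rule second_difference_mean_value[where \<phi>=\<phi> and D=D and ?D2.0="D2 v" and x=x and u=u and v=v, OF \<open>s > 0\<close>])
      (use D D2 close d1 in auto)
  obtain a' b' where ab': "0 < a'" "a' < s" "0 < b'" "b' < s"
    "\<phi> (x + s *\<^sub>R v + s *\<^sub>R u) - \<phi> (x + s *\<^sub>R v) - \<phi> (x + s *\<^sub>R u) + \<phi> x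
      = s\<^sup>2 * D2 u (x + a' *\<^sub>R v + b' *\<^sub>R u) v"
    by (rule second_difference_mean_value[where \<phi>=\<phi> and D=D and ?D2.0="D2 u" and x=x and u=v and v=u, OF \<open>s > 0\<close>])
      (use D D2 close d2 in \<open>auto simp: insert_commute\<close>)
  have "s\<^sup>2 * D2 v (x + a *\<^sub>R u + b *\<^sub>R v) u = s\<^sup>2 * D2 u (x + a' *\<^sub>R v + b' *\<^sub>R u) v"
    unfolding ab(5)[symmetric] ab'(5)[symmetric] by (simp add: algebra_simps)
  then have "D2 v (x + a *\<^sub>R u + b *\<^sub>R v) u = D2 u (x + a' *\<^sub>R v + b' *\<^sub>R u) v"
    using \<open>s > 0\<close> by simp
  moreover have "\<bar>D2 v (x + a *\<^sub>R u + b *\<^sub>R v) u - D2 v x u\<bar> < e"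
    using close[of a b u v] ab d1 by simp
  moreover have "\<bar>D2 u (x + a' *\<^sub>R v + b' *\<^sub>R u) v - D2 u x v\<bar> < e"
    using close[of a' b' v u] ab' d2 by (simp add: insert_commute)
  moreover have "\<bar>D2 v x u - D2 u x v\<bar> = 2 * e" by (simp add: e_def)
  ultimately show False by linarith
qed

lemma second_derivative_symmetric:
  fixes \<Phi> :: "'a::euclidean_space \<Rightarrow> 'b::euclidean_space"
  assumes \<Phi>: "Ck_open 2 V \<Phi>" and V: "open V" "x \<in> V"
  shows "frechet_derivative (\<lambda>y. frechet_derivative \<Phi> (at y) v) (at x) u
       = frechet_derivative (\<lambda>y. frechet_derivative \<Phi> (at y) u) (at x) v"
proof (rule euclidean_eqI)
  fix e :: 'b
  let ?D2 = "\<lambda>w y h. frechet_derivative (\<lambda>y. frechet_derivative \<Phi> (at y) w) (at y) h \<bullet> e"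
  have \<Phi>': "Ck_open (Suc (Suc 0)) V \<Phi>" using \<Phi> by (simp add: numeral_2_eq_2)
  show "?D2 v x u = ?D2 u x v"
  proof (rule second_derivative_symmetric_real[where \<phi>="\<lambda>y. \<Phi> y \<bullet> e" and ?D2.0="?D2"
        and D="\<lambda>y h. frechet_derivative \<Phi> (at y) h \<bullet> e", OF V])
    show "continuous_on V (\<lambda>y. ?D2 w y h)" for w h
      using \<Phi>' by (auto intro!: continuous_intros)
  qed (intro has_derivative_inner_left Ck_open_Suc_has_derivative[OF \<Phi>']
      Ck_open_Suc_Suc_has_derivative[OF \<Phi>']; assumption)+
qed

section \<open>Local existence of solutions\<close>

text \<open>Picard-Lindeloef: for short times the integral operator maps curves in the ball to
  curves in the ball and halves distances, so Banach's theorem yields a fixed point.\<close>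

lemma picard_local_solution:
  fixes F :: "'a::euclidean_space \<Rightarrow> 'a"
  assumes "r > 0" and lip: "L-lipschitz_on (cball x r) F"
  obtains T y where "T > 0" "y 0 = x"
    "\<And>t. t \<in> {0..T} \<Longrightarrow> y t \<in> cball x r"
    "\<And>t. t \<in> {0..T} \<Longrightarrow> (y has_vector_derivative F (y t)) (at t within {0..T})"
proof -
  have "L \<ge> 0" using lip by (rule lipschitz_on_nonneg)
  define M where "M = norm (F x) + L * r"
  have "M \<ge> 0" using \<open>L \<ge> 0\<close> \<open>r > 0\<close> by (simp add: M_def)
  have M: "norm (F z) \<le> M" if "z \<in> cball x r" for z
  proof -
    have "dist (F z) (F x) \<le> L * dist z x"
      using lip that \<open>r > 0\<close> by (intro lipschitz_onD) auto
    also have "\<dots> \<le> L * r"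
      using that \<open>L \<ge> 0\<close> by (intro mult_left_mono) (auto simp: dist_commute)
    finally have "norm (F z - F x) \<le> L * r" by (simp add: dist_norm)
    then show ?thesis unfolding M_def using norm_triangle_sub[of "F z" "F x"] by simp
  qed
  \<comment> \<open>The first bound keeps the integral of \<open>F\<close> within \<open>r\<close>,
    the second makes the contraction factor \<open>L * T\<close> at most 1/2. Adding 1 keeps the
    denominators positive if \<open>M\<close> or \<open>L\<close> is 0.\<close>
  define T where "T = min (r / (M + 1)) (1 / (2 * (L + 1)))"
  have "T > 0" using \<open>r > 0\<close> \<open>M \<ge> 0\<close> \<open>L \<ge> 0\<close> by (simp add: T_def)
  have "M * T \<le> M * (r / (M + 1))"
    using \<open>M \<ge> 0\<close> by (intro mult_left_mono) (auto simp: T_def)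
  also have "\<dots> \<le> r" using \<open>M \<ge> 0\<close> \<open>r > 0\<close> by (simp add: field_simps)
  finally have MT: "M * T \<le> r" .
  have "L * T \<le> L * (1 / (2 * (L + 1)))"
    using \<open>L \<ge> 0\<close> by (intro mult_left_mono) (auto simp: T_def)
  also have "\<dots> \<le> 1 / 2" using \<open>L \<ge> 0\<close> by (simp add: field_simps)
  finally have LT: "L * T \<le> 1 / 2" .
  \<comment> \<open>Clamping the time to \<open>[0, T]\<close> makes the Picard operator act on bounded functions on all of
    \<open>\<real>\<close>, which form a complete metric space.\<close>
  define c where "c t = max 0 (min t T)" for t :: real
  have c: "0 \<le> c t" "c t \<le> T" for t using \<open>T > 0\<close> by (auto simp: c_def)
  define S :: "(real \<Rightarrow>\<^sub>C 'a) set" where "S = PiC UNIV (\<lambda>_. cball x r)"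
  have S: "y \<in> S \<longleftrightarrow> (\<forall>t. apply_bcontfun y t \<in> cball x r)" for y
    by (auto simp: S_def mem_PiC_iff)
  have contF: "continuous_on A (\<lambda>t. F (apply_bcontfun y t))" if "y \<in> S" for y A
    by (rule continuous_on_compose2[OF lipschitz_on_continuous_on[OF lip]]) (use that S in auto)
  define P where "P y t = x + integral {0..c t} (\<lambda>s. F (apply_bcontfun y s))" for y t
  have Pball: "P y t \<in> cball x r" if "y \<in> S" for y t
  proof -
    have "norm (integral {0..c t} (\<lambda>s. F (apply_bcontfun y s))) \<le> M * (c t - 0)"
      using contF[OF that] M that c by (intro integral_bound) (auto simp: S)
    also have "\<dots> \<le> M * T" using \<open>M \<ge> 0\<close> c by (intro mult_left_mono) auto
    finally show ?thesis using MT by (simp add: P_def dist_norm)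
  qed
  have Pcont: "continuous_on UNIV (P y)" if "y \<in> S" for y
  proof -
    have "continuous_on {0..T} (\<lambda>u. integral {0..u} (\<lambda>s. F (apply_bcontfun y s)))"
      by (intro indefinite_integral_continuous_1 integrable_continuous_real contF that)
    moreover have "continuous_on UNIV c" unfolding c_def by (intro continuous_intros)
    ultimately have "continuous_on UNIV (\<lambda>t. integral {0..c t} (\<lambda>s. F (apply_bcontfun y s)))"
      by (rule continuous_on_compose2) (use c in auto)
    then show ?thesis unfolding P_def by (intro continuous_intros)
  qed
  \<comment> \<open>Being bounded and continuous, \<open>P y\<close> lifts to the type of bounded
    continuous functions; \<open>Q\<close> is the Picard operator on that type.\<close>
  have "\<exists>z. apply_bcontfun z = P y" if "y \<in> S" for y
  proof -
    have "bounded (range (P y))"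
      by (rule bounded_subset[OF bounded_cball[of x r]]) (use Pball[OF that] in auto)
    then have "P y \<in> bcontfun" using Pcont[OF that] by (simp add: bcontfun_def)
    then show ?thesis by (metis bcontfunE)
  qed
  then obtain Q where Q: "\<And>y. y \<in> S \<Longrightarrow> apply_bcontfun (Q y) = P y" by metis
  have "\<exists>!y. y \<in> S \<and> Q y = y"
  proof (rule Banach_fix[where c="1/2"])
    show "complete S" unfolding S_def by (intro closed_PiC complete_eq_closed[THEN iffD2]) auto
    show "S \<noteq> {}"
      using S[of "const_bcontfun x"] \<open>r > 0\<close> by auto
    show "Q ` S \<subseteq> S" using Pball by (auto simp: S Q)
    show "dist (Q y) (Q z) \<le> 1 / 2 * dist y z" if "y \<in> S" "z \<in> S" for y z
    proof (rule dist_bound)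
      fix t
      have "dist (P y t) (P z t)
          = norm (integral {0..c t} (\<lambda>s. F (apply_bcontfun y s) - F (apply_bcontfun z s)))"
        by (simp add: P_def dist_norm integral_diff integrable_continuous_real contF that)
      also have "\<dots> \<le> L * dist y z * (c t - 0)"
      proof (rule integral_bound)
        fix s
        have "norm (F (apply_bcontfun y s) - F (apply_bcontfun z s))
            \<le> L * dist (apply_bcontfun y s) (apply_bcontfun z s)"
          using lipschitz_onD[OF lip] that S by (metis dist_norm)
        also have "\<dots> \<le> L * dist y z"
          using \<open>L \<ge> 0\<close> by (intro mult_left_mono dist_bounded)
        finally show "norm (F (apply_bcontfun y s) - F (apply_bcontfun z s)) \<le> L * dist y z" .
      qed (use c contF that in \<open>auto intro!: continuous_intros\<close>)
      also have "\<dots> = (L * c t) * dist y z" by simp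
      also have "\<dots> \<le> (L * T) * dist y z"
        using \<open>L \<ge> 0\<close> c by (intro mult_right_mono mult_left_mono) auto
      also have "\<dots> \<le> 1 / 2 * dist y z"
        using LT by (intro mult_right_mono) auto
      finally show "dist (apply_bcontfun (Q y) t) (apply_bcontfun (Q z) t) \<le> 1 / 2 * dist y z"
        by (simp add: Q that)
    qed
  qed auto
  then obtain y where y: "y \<in> S" "Q y = y" by blast
  then have yP: "apply_bcontfun y t = P y t" for t using Q[of y] by simp
  show thesis
  proof (rule that[of T "apply_bcontfun y"])
    show "T > 0" by fact
    show "apply_bcontfun y 0 = x" unfolding yP using \<open>T > 0\<close> by (simp add: P_def c_def)
    show "apply_bcontfun y t \<in> cball x r" for t using y S by blast
    fix t assume t: "t \<in> {0..T}"
    have "((\<lambda>u. integral {0..u} (\<lambda>s. F (apply_bcontfun y s))) has_vector_derivative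
        F (apply_bcontfun y t)) (at t within {0..T})"
      by (rule integral_has_vector_derivative[OF contF[OF y(1)] t])
    then have deriv: "((\<lambda>u. x + integral {0..u} (\<lambda>s. F (apply_bcontfun y s))) has_vector_derivative
        F (apply_bcontfun y t)) (at t within {0..T})"
      by (auto intro!: derivative_eq_intros)
    \<comment> \<open>On \<open>{0..T}\<close> the clamp \<open>c\<close> is the identity, so the
      fixed point equation is the integral equation.\<close>
    have eq: "apply_bcontfun y u = x + integral {0..u} (\<lambda>s. F (apply_bcontfun y s))"
      if "u \<in> {0..T}" for u
    proof -
      have "c u = u" using that by (simp add: c_def)
      then show ?thesis unfolding yP[of u] P_def by simp
    qed
    show "(apply_bcontfun y has_vector_derivative F (apply_bcontfun y t)) (at t within {0..T})"
      by (rule has_vector_derivative_transform[OF t eq deriv])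
  qed
qed

section \<open>Lie brackets and pushforwards\<close>

text \<open>A product rule for a direction that varies with the point. Second derivatives are
  available only for a fixed direction, so \<open>w y\<close> is expanded in the basis and its
  coordinates are differentiated as scalar factors.\<close>

lemma has_derivative_frechet_derivative_apply:
  fixes \<Phi> :: "'a::euclidean_space \<Rightarrow> 'b::euclidean_space"
  assumes \<Phi>: "Ck_open 2 V \<Phi>" and V: "open V" "x \<in> V"
    and w: "(w has_derivative w') (at x)"
  shows "((\<lambda>y. frechet_derivative \<Phi> (at y) (w y)) has_derivative
           (\<lambda>h. frechet_derivative (\<lambda>y. frechet_derivative \<Phi> (at y) (w x)) (at x) h
                + frechet_derivative \<Phi> (at x) (w' h))) (at x)"
proof -
  let ?D = "\<lambda>y. frechet_derivative \<Phi> (at y)"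
  let ?D2 = "\<lambda>v. frechet_derivative (\<lambda>y. ?D y v) (at x)"
  have \<Phi>': "Ck_open (Suc (Suc 0)) V \<Phi>" using \<Phi> by (simp add: numeral_2_eq_2)
  have D: "linear (?D y)" if "y \<in> V" for y
    using Ck_open_Suc_has_derivative[OF \<Phi>' that] by (rule has_derivative_linear)
  have D2: "(((\<lambda>y. ?D y v)) has_derivative ?D2 v) (at x)" for v
    by (rule Ck_open_Suc_Suc_has_derivative[OF \<Phi>' V(2)])
  \<comment> \<open>As a derivative, \<open>?D2 v\<close> is linear in its argument
    \<open>h\<close>; symmetry transfers the linearity to the direction \<open>v\<close>.\<close>
  have D2_expand: "?D2 v h = (\<Sum>b\<in>Basis. (v \<bullet> b) *\<^sub>R ?D2 b h)" for v h
    using linear_euclidean_representation[OF has_derivative_linear[OF D2], of h v]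
    by (simp add: second_derivative_symmetric[OF \<Phi> V, of _ h])
  have "((\<lambda>y. \<Sum>b\<in>Basis. (w y \<bullet> b) *\<^sub>R ?D y b) has_derivative
      (\<lambda>h. \<Sum>b\<in>Basis. (w x \<bullet> b) *\<^sub>R ?D2 b h + (w' h \<bullet> b) *\<^sub>R ?D x b)) (at x)"
    by (intro has_derivative_sum has_derivative_scaleR has_derivative_inner_left w D2)
  moreover have "(\<Sum>b\<in>Basis. (w x \<bullet> b) *\<^sub>R ?D2 b h + (w' h \<bullet> b) *\<^sub>R ?D x b)
      = ?D2 (w x) h + ?D x (w' h)" for h
    by (simp add: sum.distrib flip: D2_expand linear_euclidean_representation[OF D[OF V(2)]])
  ultimately have "((\<lambda>y. \<Sum>b\<in>Basis. (w y \<bullet> b) *\<^sub>R ?D y b) has_derivative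
      (\<lambda>h. ?D2 (w x) h + ?D x (w' h))) (at x)" by simp
  then show ?thesis
    by (rule has_derivative_transform_within_open[OF _ V]) (metis linear_euclidean_representation[OF D])
qed

text \<open>Pushing forward commutes with brackets: in \<open>a (w x) - b (v x)\<close> the two
  second-order terms cancel by symmetry. The pushed vectors are treated as functions of
  \<open>y\<close>, since the image of \<open>\<Phi>\<close> need not be open and carries no
  ordinary derivatives.\<close>

lemma frechet_derivative_lie_bracket:
  fixes \<Phi> :: "real^'n \<Rightarrow> 'b::euclidean_space"
  assumes \<Phi>: "Ck_open 2 V \<Phi>" and V: "open V" "x \<in> V"
    and v: "v differentiable (at x)" and w: "w differentiable (at x)"
    and \<Phi>v: "((\<lambda>y. frechet_derivative \<Phi> (at y) (v y)) has_derivative a) (at x)"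
    and \<Phi>w: "((\<lambda>y. frechet_derivative \<Phi> (at y) (w y)) has_derivative b) (at x)"
  shows "frechet_derivative \<Phi> (at x) (lie_bracket v w x) = a (w x) - b (v x)"
proof -
  let ?D = "frechet_derivative \<Phi> (at x)"
  let ?D2 = "\<lambda>v. frechet_derivative (\<lambda>y. frechet_derivative \<Phi> (at y) v) (at x)"
  have "linear ?D"
    using \<Phi> V by (intro linear_frechet_derivative) (simp add: numeral_2_eq_2)
  then have "?D (lie_bracket v w x)
      = ?D (jacobian v (at x) *v w x) - ?D (jacobian w (at x) *v v x)"
    by (simp add: lie_bracket_def linear_diff)
  moreover have "a = (\<lambda>h. ?D2 (v x) h + ?D (jacobian v (at x) *v h))"
    using \<Phi>v has_derivative_frechet_derivative_apply[OF \<Phi> V v[unfolded jacobian_works]]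
    by (rule has_derivative_unique)
  moreover have "b = (\<lambda>h. ?D2 (w x) h + ?D (jacobian w (at x) *v h))"
    using \<Phi>w has_derivative_frechet_derivative_apply[OF \<Phi> V w[unfolded jacobian_works]]
    by (rule has_derivative_unique)
  ultimately show ?thesis
    using second_derivative_symmetric[OF \<Phi> V, of "v x" "w x"] by simp
qed

section \<open>Differentiating the inverse of the lift\<close>

text \<open>Here \<open>h\<close> is a local extension of the inverse to an open set around
  \<open>\<Phi> x\<close>. Since \<open>h\<close> after \<open>\<Phi>\<close> is the identity near
  \<open>x\<close>, the chain rule makes the derivative of \<open>h\<close> a left inverse of that
  of \<open>\<Phi>\<close>.\<close>

lemma Ck_diffeo_onto_image_local_left_inverse:
  assumes \<Phi>: "Ck_diffeo_onto_image 2 S \<Phi>" and V: "open V" "V \<subseteq> S" "x \<in> V"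
  shows "\<exists>W h. open W \<and> x \<in> W \<and> W \<subseteq> V \<and>
    (\<forall>y\<in>W. \<forall>v. frechet_derivative h (at (\<Phi> y)) (frechet_derivative \<Phi> (at y) v) = v) \<and>
    (\<forall>c. (\<lambda>z. frechet_derivative h (at z) c) differentiable (at (\<Phi> x)))"
proof -
  have \<Phi>2: "Ck_open 2 V \<Phi>"
    by (rule Ck_diffeo_onto_image_imp_Ck_open[OF \<Phi> V(1,2)]) (simp add: numeral_eq_enat)
  then have \<Phi>': "Ck_open (Suc (Suc 0)) V \<Phi>" by (simp add: numeral_2_eq_2)
  obtain \<Psi> where \<Psi>: "Ck_on 2 (\<Phi> ` S) \<Psi>" "\<And>x. x \<in> S \<Longrightarrow> \<Psi> (\<Phi> x) = x"
    using \<Phi> unfolding Ck_diffeo_onto_image_def by blast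
  have "\<Phi> x \<in> \<Phi> ` S" using V by auto
  then obtain U h where U: "open U" "\<Phi> x \<in> U" "\<forall>j. enat j \<le> 2 \<longrightarrow> Ck_open j U h"
      "\<forall>y\<in>\<Phi> ` S \<inter> U. h y = \<Psi> y"
    using \<Psi>(1) unfolding Ck_on_def by meson
  have "Ck_open 2 U h"
    using U(3)[THEN spec, of 2] by (simp add: numeral_eq_enat)
  then have h: "Ck_open (Suc (Suc 0)) U h" by (simp add: numeral_2_eq_2)
  define W where "W = V \<inter> \<Phi> -` U"
  have "continuous_on V \<Phi>"
    using Ck_open_Suc_has_derivative[OF \<Phi>']
    by (meson continuous_at_imp_continuous_on has_derivative_continuous)
  then have "open W"
    unfolding W_def using V(1) U(1) by (rule continuous_open_preimage)
  have "frechet_derivative h (at (\<Phi> y)) (frechet_derivative \<Phi> (at y) v) = v" if y: "y \<in> W" for y v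
  proof -
    have "((\<lambda>y. h (\<Phi> y)) has_derivative
        (\<lambda>v. frechet_derivative h (at (\<Phi> y)) (frechet_derivative \<Phi> (at y) v))) (at y)"
      by (rule has_derivative_compose[OF Ck_open_Suc_has_derivative[OF \<Phi>']
            Ck_open_Suc_has_derivative[OF h]]) (use y in \<open>auto simp: W_def\<close>)
    moreover have "((\<lambda>y. h (\<Phi> y)) has_derivative (\<lambda>v. v)) (at y)"
      by (rule has_derivative_transform_within_open[OF has_derivative_ident \<open>open W\<close> y])
        (use U(4) \<Psi>(2) V in \<open>auto simp: W_def\<close>)
    ultimately show ?thesis
      by (metis has_derivative_unique)
  qed
  moreover have "(\<lambda>z. frechet_derivative h (at z) c) differentiable (at (\<Phi> x))" for c
    using h U(2) by simp
  moreover have "x \<in> W" "W \<subseteq> V" using U(2) V(3) by (auto simp: W_def)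
  ultimately show ?thesis
    using \<open>open W\<close> by (intro exI[of _ W] exI[of _ h] conjI ballI allI)
qed

lemma Ck_diffeo_onto_image_inj_frechet_derivative:
  fixes \<Phi> :: "'a::euclidean_space \<Rightarrow> 'b::euclidean_space"
  assumes "Ck_diffeo_onto_image 2 S \<Phi>" "open V" "V \<subseteq> S" "x \<in> V"
  shows "inj (frechet_derivative \<Phi> (at x))"
proof -
  obtain W and h :: "'b \<Rightarrow> 'a" where "x \<in> W"
    and h: "\<forall>y\<in>W. \<forall>v. frechet_derivative h (at (\<Phi> y)) (frechet_derivative \<Phi> (at y) v) = v"
    using Ck_diffeo_onto_image_local_left_inverse[OF assms] by (elim exE conjE) (rule that)
  then show ?thesis
    by (intro inj_on_inverseI[where g="frechet_derivative h (at (\<Phi> x))"]) simp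
qed

text \<open>Such a field is \<open>v(y) = D\<Psi>(\<Phi>(y)) c\<close> for the local extension \<open>\<Psi>\<close> of the inverse of \<open>\<Phi>\<close>, so the
  differentiability of iterated brackets needs no product rule for higher derivatives.\<close>

lemma constant_pushforward_imp_differentiable:
  fixes \<Phi> :: "'a::euclidean_space \<Rightarrow> 'b::euclidean_space"
  assumes \<Phi>: "Ck_diffeo_onto_image 2 S \<Phi>" and V: "open V" "V \<subseteq> S" "x \<in> V"
    and c: "\<And>y. y \<in> V \<Longrightarrow> frechet_derivative \<Phi> (at y) (v y) = c"
  shows "v differentiable (at x)"
proof -
  obtain W and h :: "'b \<Rightarrow> 'a" where W: "open W" "x \<in> W" "W \<subseteq> V"
    "\<forall>y\<in>W. \<forall>v. frechet_derivative h (at (\<Phi> y)) (frechet_derivative \<Phi> (at y) v) = v"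
    "\<forall>c. (\<lambda>z. frechet_derivative h (at z) c) differentiable (at (\<Phi> x))"
    using Ck_diffeo_onto_image_local_left_inverse[OF \<Phi> V] by (elim exE conjE) (rule that)
  have "Ck_open 2 V \<Phi>"
    by (rule Ck_diffeo_onto_image_imp_Ck_open[OF \<Phi> V(1,2)]) (simp add: numeral_eq_enat)
  then have "\<Phi> differentiable (at x)"
    using V by (simp add: numeral_2_eq_2)
  then obtain D where "((\<lambda>y. frechet_derivative h (at (\<Phi> y)) c) has_derivative D) (at x)"
    using differentiable_chain_at[of \<Phi> x "\<lambda>z. frechet_derivative h (at z) c"] W(5)
    by (auto simp: o_def differentiable_def)
  then have "(v has_derivative D) (at x)"
  proof (rule has_derivative_transform_within_open[OF _ W(1,2)])
    show "frechet_derivative h (at (\<Phi> y)) c = v y" if "y \<in> W" for y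
      using W(3,4) c[of y] that by (metis subsetD)
  qed
  then show ?thesis by (rule differentiableI)
qed

section \<open>From trajectories to an identity of vector fields\<close>

text \<open>The assumption \<open>lift\<close> speaks only of trajectories, so one through
  \<open>x\<close> must be produced: a \<open>C^1\<close> field is Lipschitz on a small ball, which
  gives a solution for the constant input \<open>c\<close> that stays in \<open>V\<close>.\<close>

lemma koopman_pushforward:
  fixes f :: "real^'n \<Rightarrow> real^'n" and g :: "'m::finite \<Rightarrow> real^'n \<Rightarrow> real^'n"
    and \<Phi> :: "real^'n \<Rightarrow> real^'N"
  assumes f: "Ck_open 1 V f" and g: "\<And>i. Ck_open 1 V (g i)"
    and V: "open V" "V \<subseteq> X\<^sub>0" "X\<^sub>0 \<subseteq> X" "x \<in> V"
    and \<Phi>: "\<Phi> differentiable (at x)"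
    and lift: "\<And>u T z t. \<lbrakk>trajectory X f g u T z; z 0 \<in> X\<^sub>0; t \<in> {0..<T};
        ereal t < exit_time X\<^sub>0 T z\<rbrakk> \<Longrightarrow>
      ((\<lambda>s. \<Phi> (z s)) has_vector_derivative (A *v \<Phi> (z t) + B *v u t)) (at t within {0..<T})"
  shows "frechet_derivative \<Phi> (at x) (f x + (\<Sum>i\<in>UNIV. (c $ i) *\<^sub>R g i x)) = A *v \<Phi> x + B *v c"
proof -
  define F where "F y = f y + (\<Sum>i\<in>UNIV. (c $ i) *\<^sub>R g i y)" for y
  obtain r where r: "r > 0" "cball x r \<subseteq> V"
    using V open_contains_cball by blast
  obtain Lf where Lf: "Lf-lipschitz_on (cball x r) f"
    using Ck_open_Suc_lipschitz_on_cball f r(2) by (metis One_nat_def)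
  have "\<exists>L. L-lipschitz_on (cball x r) (g i)" for i
    using Ck_open_Suc_lipschitz_on_cball g r(2) by (metis One_nat_def)
  then obtain Lg where Lg: "\<And>i. (Lg i)-lipschitz_on (cball x r) (g i)" by metis
  have "\<exists>L. L-lipschitz_on (cball x r) (\<lambda>y. \<Sum>i\<in>I. (c $ i) *\<^sub>R g i y)" if "finite I" for I
    using that
  proof (induction I)
    case empty
    show ?case by (auto intro: lipschitz_on_constant)
  next
    case (insert i I)
    then obtain L where L: "L-lipschitz_on (cball x r) (\<lambda>y. \<Sum>i\<in>I. (c $ i) *\<^sub>R g i y)"
      by blast
    have "(\<bar>c $ i\<bar> * Lg i + L)-lipschitz_on (cball x r)
        (\<lambda>y. (c $ i) *\<^sub>R g i y + (\<Sum>i\<in>I. (c $ i) *\<^sub>R g i y))"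
      by (intro lipschitz_on_add lipschitz_on_cmult Lg L)
    then show ?case using insert.hyps by auto
  qed
  then obtain L where "L-lipschitz_on (cball x r) (\<lambda>y. \<Sum>i\<in>UNIV. (c $ i) *\<^sub>R g i y)"
    using finite by blast
  then have "(Lf + L)-lipschitz_on (cball x r) F"
    unfolding F_def using Lf by (intro lipschitz_on_add)
  then obtain T z where z: "T > 0" "z 0 = x"
    "\<And>t. t \<in> {0..T} \<Longrightarrow> z t \<in> cball x r"
    "\<And>t. t \<in> {0..T} \<Longrightarrow> (z has_vector_derivative F (z t)) (at t within {0..T})"
    using picard_local_solution[OF r(1)] by metis
  have dz: "(z has_vector_derivative F (z t)) (at t within {0..<T})" if "t \<in> {0..<T}" for t
    by (rule has_vector_derivative_within_subset[OF z(4)]) (use that in auto)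
  have inX0: "z t \<in> X\<^sub>0" if "t \<in> {0..<T}" for t
    using z(3)[of t] that r V by auto
  have "trajectory X f g (\<lambda>_. c) T z"
    using dz inX0 V unfolding trajectory_def F_def by auto
  \<comment> \<open>The solution never leaves \<open>X\<^sub>0\<close>, and the infimum of the empty
    set is infinite, so \<open>lift\<close> applies at time 0.\<close>
  moreover have "{\<tau>. 0 < \<tau> \<and> \<tau> < T \<and> z \<tau> \<notin> X\<^sub>0} = {}"
    using inX0 by auto
  then have "exit_time X\<^sub>0 T z = \<infinity>"
    by (simp add: exit_time_def top_ereal_def del: Collect_empty_eq)
  ultimately have "((\<lambda>s. \<Phi> (z s)) has_vector_derivative (A *v \<Phi> x + B *v c)) (at 0 within {0..<T})"
    using lift[of "\<lambda>_. c" T z 0] z(1,2) inX0[of 0] by simp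
  moreover have "((\<lambda>s. \<Phi> (z s)) has_vector_derivative frechet_derivative \<Phi> (at x) (F x))
      (at 0 within {0..<T})"
    using vector_derivative_diff_chain_within[of z "F x" 0 "{0..<T}" \<Phi> "frechet_derivative \<Phi> (at x)"]
      dz[of 0] z(1,2) \<Phi>
    by (auto simp: o_def frechet_derivative_works intro: has_derivative_at_withinI)
  \<comment> \<open>Uniqueness of the one-sided derivative requires 0 to be a limit point of the
    time interval.\<close>
  moreover have "at 0 within {0..<T} \<noteq> bot"
  proof -
    have "at 0 within {0..<T} = at_right 0"
      by (rule at_within_nhd[where S="{..<T}"]) (use z(1) in auto)
    then show ?thesis by simp
  qed
  ultimately show ?thesis
    unfolding F_def
    by (metis vector_derivative_unique_within)
qed

section \<open>Iterated brackets as preimages of constant vectors\<close>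

theorem theorem1:
  fixes X :: "(real^'n) set"
    and f :: "real^'n \<Rightarrow> real^'n"
    and g :: "'m::finite \<Rightarrow> real^'n \<Rightarrow> real^'n"
    and x\<^sub>0 :: "real^'n"
  assumes "Ck_on \<infinity> X f"
    and "\<And>i. Ck_on \<infinity> X (g i)"
    and "x\<^sub>0 \<in> X"
    and "f x\<^sub>0 = 0"
    and "koopman_linearizable TYPE('N::finite) X f g x\<^sub>0"
  shows "\<exists>V. open V \<and> x\<^sub>0 \<in> V \<and> V \<subseteq> X \<and>
    (\<lambda>x. dim (span {ad f j (g i) x | i j. True})) constant_on V \<and>
    (\<forall>i j k l. \<forall>x\<in>V. lie_bracket (ad f k (g i)) (ad f l (g j)) x = 0)"
proof -
  obtain X\<^sub>0 and \<Phi> :: "real^'n \<Rightarrow> real^'N" and A :: "real^'N^'N" and B :: "real^'m^'N"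
    where X\<^sub>0: "X\<^sub>0 \<subseteq> X" "x\<^sub>0 \<in> interior X\<^sub>0" and \<Phi>: "Ck_diffeo_onto_image 2 X\<^sub>0 \<Phi>"
    and lift: "\<And>u T z t. \<lbrakk>trajectory X f g u T z; z 0 \<in> X\<^sub>0; t \<in> {0..<T};
        ereal t < exit_time X\<^sub>0 T z\<rbrakk> \<Longrightarrow>
      ((\<lambda>s. \<Phi> (z s)) has_vector_derivative (A *v \<Phi> (z t) + B *v u t)) (at t within {0..<T})"
    using assms(5) unfolding koopman_linearizable_def by blast
  \<comment> \<open>\<open>X\<^sub>0\<close> need not be open; its interior contains
    \<open>x\<^sub>0\<close> and serves both conclusions.\<close>
  define V where "V = interior X\<^sub>0"
  have V: "open V" "V \<subseteq> X\<^sub>0" by (auto simp: V_def interior_subset)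
  then have "V \<subseteq> X" using X\<^sub>0 by blast
  let ?D = "\<lambda>x. frechet_derivative \<Phi> (at x)"
  have \<Phi>2: "Ck_open 2 V \<Phi>"
    by (rule Ck_diffeo_onto_image_imp_Ck_open[OF \<Phi> V(1,2)]) (simp add: numeral_eq_enat)
  have \<Phi>_diff: "\<Phi> differentiable (at x)" if "x \<in> V" for x
    using \<Phi>2 that by (simp add: numeral_2_eq_2)
  then have lin: "linear (?D x)" if "x \<in> V" for x
    using that by (intro linear_frechet_derivative)
  have inj: "inj (?D x)" if "x \<in> V" for x
    by (rule Ck_diffeo_onto_image_inj_frechet_derivative[OF \<Phi> V that])
  have C1: "Ck_open 1 V f" "Ck_open 1 V (g i)" for i
    by (auto intro!: Ck_on_imp_Ck_open[OF _ V(1) \<open>V \<subseteq> X\<close>] assms(1,2) simp del: Ck_open.simps One_nat_def)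
  have push: "?D x (f x + (\<Sum>i\<in>UNIV. (c $ i) *\<^sub>R g i x)) = A *v \<Phi> x + B *v c" if "x \<in> V" for x c
    by (rule koopman_pushforward[OF C1 V X\<^sub>0(1) that \<Phi>_diff[OF that]]) (rule lift)
  \<comment> \<open>Input 0 isolates the drift; the unit inputs below then isolate each control
    field by subtraction.\<close>
  have push_f: "?D x (f x) = A *v \<Phi> x" if "x \<in> V" for x
    using push[OF that, of 0] by simp
  have push_g: "?D x (g i x) = B *v axis i 1" if "x \<in> V" for x i
  proof -
    have "(\<Sum>j\<in>UNIV. (axis i 1 $ j) *\<^sub>R g j x) = (\<Sum>j\<in>UNIV. if j = i then g j x else 0)"
      by (intro sum.cong) (auto simp: axis_def)
    then have "?D x (f x + g i x) = A *v \<Phi> x + B *v axis i 1"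
      using push[OF that, of "axis i 1"] by simp
    then show ?thesis using push_f[OF that] lin[OF that] by (simp add: linear_add)
  qed
  \<comment> \<open>The vector \<open>A^k b_i\<close>, where \<open>b_i\<close> is column
    \<open>i\<close> of \<open>B\<close>.\<close>
  define C where "C k i = ((*v) A ^^ k) (B *v axis i 1)" for k i
  have const_deriv: "((\<lambda>y. ?D y (v y)) has_derivative (\<lambda>_. 0)) (at x)"
    if "x \<in> V" "\<And>y. y \<in> V \<Longrightarrow> ?D y (v y) = c" for v c x
    by (rule has_derivative_transform_within_open[OF has_derivative_const V(1) that(1)])
      (use that(2) in auto)
  have push_ad: "?D x (ad f k (g i) x) = C k i" if "x \<in> V" for x k i
    using that
  proof (induction k arbitrary: x)
    case 0
    then show ?case by (simp add: C_def push_g)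
  next
    case (Suc k)
    have "((\<lambda>y. A *v \<Phi> y) has_derivative (\<lambda>h. A *v ?D x h)) (at x)"
      using \<Phi>_diff[OF Suc.prems] unfolding frechet_derivative_works
      by (rule bounded_linear.has_derivative[OF matrix_vector_mul_bounded_linear])
    then have "((\<lambda>y. ?D y (f y)) has_derivative (\<lambda>h. A *v ?D x h)) (at x)"
      by (rule has_derivative_transform_within_open[OF _ V(1) Suc.prems]) (simp add: push_f)
    moreover have "f differentiable (at x)" using C1(1) Suc.prems by simp
    \<comment> \<open>The induction hypothesis on all of \<open>V\<close> supplies this: a field
      with constant pushforward is differentiable.\<close>
    moreover have "ad f k (g i) differentiable (at x)"
      using Suc by (intro constant_pushforward_imp_differentiable[OF \<Phi> V]) auto
    \<comment> \<open>The pushforward of \<open>f\<close> has derivative \<open>A\<close> after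
      \<open>?D x\<close>; that of \<open>ad f k (g i)\<close> is constant and contributes 0. With
      this sign convention each bracket with \<open>f\<close> multiplies by \<open>A\<close>, not by
      its negative.\<close>
    ultimately have "?D x (lie_bracket f (ad f k (g i)) x) = A *v ?D x (ad f k (g i) x) - 0"
      using Suc by (intro frechet_derivative_lie_bracket[OF \<Phi>2 V(1)] const_deriv) auto
    then show ?case using Suc by (simp add: C_def)
  qed
  have bracket: "lie_bracket (ad f k (g i)) (ad f l (g j)) x = 0" if "x \<in> V" for i j k l x
  proof -
    have "ad f k (g i) differentiable (at x)" for k i
      using push_ad by (intro constant_pushforward_imp_differentiable[OF \<Phi> V that]) auto
    then have "?D x (lie_bracket (ad f k (g i)) (ad f l (g j)) x) = 0 - 0"
      using push_ad that
      by (intro frechet_derivative_lie_bracket[OF \<Phi>2 V(1) that] const_deriv) auto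
    then show ?thesis
      using inj[OF that] lin[OF that] by (simp add: linear_injective_0)
  qed
  \<comment> \<open>The right-hand side does not depend on \<open>x\<close>: the injective map
    \<open>?D x\<close> carries the brackets at every \<open>x\<close> onto the same set of
    vectors.\<close>
  have "dim (span {ad f j (g i) x | i j. True}) = dim {C j i | i j. True}" if "x \<in> V" for x
  proof -
    have "?D x ` {ad f j (g i) x | i j. True} = {C j i | i j. True}"
      using push_ad[OF that] by (force simp: image_iff)
    moreover have "dim (?D x ` {ad f j (g i) x | i j. True}) = dim {ad f j (g i) x | i j. True}"
      using lin[OF that] inj[OF that] by (intro dim_image_eq) (auto intro: inj_on_subset)
    ultimately show ?thesis by simp
  qed
  then have "(\<lambda>x. dim (span {ad f j (g i) x | i j. True})) constant_on V"
    unfolding constant_on_def by blast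
  with bracket V X\<^sub>0 \<open>V \<subseteq> X\<close> show ?thesis
    by (intro exI[of _ V]) (auto simp: V_def)
qed

end
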